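(* Let $\mathrm{Br}$ be the best response function and $P$ the limiting distribution function of the agents' parameters as described in the context, with $\mathrm{Br}$ Lipschitz in $z$ with constant $L_z<1$ and Lipschitz in $\alpha$ with constant $L$. Let $Q(\cdot)$ be a quantization scheme for $P$, let $z^\star_{\rm AEM}$ be the asymptotic equilibrium mean, and let $\hat z^\star_{\rm AEM}$ be the $Q(\cdot)$-based approximation of $z^\star_{\rm AEM}$, i.e. the solution of $\hat z^\star_{\rm AEM}=\mathsf{E}_\nu\left[\mathrm{Br}(\hat z^\star_{\rm AEM},Q(\nu))\right]$. Then $$\left|z^\star_{\rm AEM}-\hat z^\star_{\rm AEM}\right|\le\frac{L}{1-L_z}\,\mathsf{E}_\nu\left[\left|\nu-Q(\nu)\right|\right],$$ where $\nu$ is a random variable with distribution function $P$.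
   Context: Let $a\le b$ be reals, $u:[a,b]\times\mathbb{R}\times\mathbb{R}\to\mathbb{R}$ a utility function $u(x,z,\alpha)$ (action $x$, mean of the other agents' actions $z$, parameter $\alpha$), and $(\alpha_i)_{i\ge1}$ a deterministic sequence of reals (the agents' parameters). Best response. $\mathrm{Br}(z,\alpha)=\arg\max_{a\le x\le b}u(x,z,\alpha)$; for all $z,\alpha\in\mathbb{R}$ the maximizer is assumed to exist and be unique, so $\mathrm{Br}:\mathbb{R}\times\mathbb{R}\to[a,b]$ is a function. Assumptions. (1) There is a constant $0<L_z<1$ with $|\mathrm{Br}(z,\alpha)-\mathrm{Br}(z',\alpha)|\le L_z|z-z'|$ for all $z,z',\alpha\in\mathbb{R}$. (2) There is a constant $L>0$ with $|\mathrm{Br}(z,\alpha)-\mathrm{Br}(z,\alpha')|\le L|\alpha-\alpha'|$ for all $z,\alpha,\alpha'\in\mathbb{R}$. (3) With $P_n(\alpha)=\frac1n\sum_{i=1}^n \mathbf{1}\{\alpha_i\le\alpha\}$, there is a continuous (probability) distribution function $P$ such that $\lim_{n\to\infty}P_n(\alpha)=P(\alpha)$ for all $\alpha\in\mathbb{R}$. Asymptotic equilibrium mean. $z^\star_{\rm AEM}$ is the (unique) solution $z$ of $z=\int_{-\infty}^{\infty}\mathrm{Br}(z,\alpha)\,dP(\alpha)=\mathsf{E}_\nu[\mathrm{Br}(z,\nu)]$, with $\nu\sim P$. Quantization. A quantization scheme $Q(\cdot)$ is a (measurable, at most countable) partition of $\mathbb{R}$ into cells $\mathrm{B}_m$, each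 with a corresponding cell center $q_m\in\mathbb{R}$, and $Q(\alpha)=q_m$ for $\alpha\in\mathrm{B}_m$. The $Q(\cdot)$-based approximation $\hat z^\star_{\rm AEM}$ is the (unique) solution $z$ of $z=\sum_m\mathrm{Br}(z,q_m)\Pr(\nu\in\mathrm{B}_m)=\mathsf{E}_\nu[\mathrm{Br}(z,Q(\nu))]$. *)

theory Defs
  imports "HOL-Probability.Probability"
begin

text \<open>Only the values \<open>u x z \<alpha>\<close> with \<open>x \<in> {a..b}\<close> matter. \<open>arg_max_on\<close> picks an arbitrary maximizer, so
  \<open>best_response\<close> is meaningful only under \<open>unique_maximizer\<close>.\<close>

definition best_response :: "real \<Rightarrow> real \<Rightarrow> (real \<Rightarrow> real \<Rightarrow> real \<Rightarrow> real) \<Rightarrow> real \<Rightarrow> real \<Rightarrow> real" where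
  "best_response a b u z \<alpha> = arg_max_on (\<lambda>x. u x z \<alpha>) {a..b}"

definition unique_maximizer :: "real \<Rightarrow> real \<Rightarrow> (real \<Rightarrow> real \<Rightarrow> real \<Rightarrow> real) \<Rightarrow> bool" where
  "unique_maximizer a b u \<longleftrightarrow>
     (\<forall>z \<alpha>. \<exists>!x. is_arg_max (\<lambda>x. u x z \<alpha>) (\<lambda>x. x \<in> {a..b}) x)"

text \<open>The sequence is indexed from 1; the value of \<open>\<alpha> 0\<close> is never used.\<close>

definition empirical_df :: "(nat \<Rightarrow> real) \<Rightarrow> nat \<Rightarrow> real \<Rightarrow> real" where
  "empirical_df \<alpha> n x = (1 / real n) * (\<Sum>i=1..n. of_bool (\<alpha> i \<le> x))"

definition distribution_function :: "(real \<Rightarrow> real) \<Rightarrow> bool" where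
  "distribution_function P \<longleftrightarrow>
     mono P \<and> (\<forall>x. continuous (at_right x) P) \<and> (P \<longlongrightarrow> 0) at_bot \<and> (P \<longlongrightarrow> 1) at_top"

text \<open>\<open>interval_measure P\<close> is the Lebesgue--Stieltjes measure \<open>dP\<close>.\<close>

definition aem :: "real \<Rightarrow> real \<Rightarrow> (real \<Rightarrow> real \<Rightarrow> real \<Rightarrow> real) \<Rightarrow> (real \<Rightarrow> real) \<Rightarrow> real" where
  "aem a b u P = (THE z. z = (LINT \<alpha>|interval_measure P. best_response a b u z \<alpha>))"

text \<open>The cells are the members of \<open>\<B>\<close>, and \<open>q B\<close> is the center of the cell \<open>B\<close>; it need not lie in \<open>B\<close>.\<close>

definition quantization_scheme ::
    "real set set \<Rightarrow> (real set \<Rightarrow> real) \<Rightarrow> (real \<Rightarrow> real) \<Rightarrow> bool" where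
  "quantization_scheme \<B> q Q \<longleftrightarrow>
     partition_on UNIV \<B> \<and> countable \<B> \<and> \<B> \<subseteq> sets borel \<and> (\<forall>B\<in>\<B>. \<forall>\<alpha>\<in>B. Q \<alpha> = q B)"

definition aem_approx :: "real \<Rightarrow> real \<Rightarrow> (real \<Rightarrow> real \<Rightarrow> real \<Rightarrow> real) \<Rightarrow>
    'w measure \<Rightarrow> ('w \<Rightarrow> real) \<Rightarrow> (real \<Rightarrow> real) \<Rightarrow> real" where
  "aem_approx a b u M \<nu> Q = (THE z. z = (LINT \<omega>|M. best_response a b u z (Q (\<nu> \<omega>))))"

end

theory Submission imports Defs begin

text \<open>
  The two equilibrium means are fixed points of the averaged responses
  \<open>z \<mapsto> E (Br z \<nu>)\<close> and \<open>z \<mapsto> E (Br z (Q \<nu>))\<close>. Averaging preserves the Lipschitz constant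
  \<open>Lz < 1\<close> in \<open>z\<close>, so both maps are contractions of the real line. Banach's theorem makes each fixed
  point exist and be unique (\<open>ex1_mean_fixpoint\<close>), which is what gives the definite descriptions
  \<open>aem\<close> and \<open>aem_approx\<close> a meaning.

  Fixed points of nearby contractions are close: for \<open>z = E (f z)\<close> and \<open>z' = E (g z')\<close>, the
  triangle inequality through \<open>E (f z')\<close> gives
  \<open>\<bar>z - z'\<bar> \<le> Lz * \<bar>z - z'\<bar> + E \<bar>f z' - g z'\<bar>\<close>, and the first term on the right is absorbed on the
  left (\<open>mean_fixpoint_perturbation\<close>). The Lipschitz bound in the parameter turns the remaining
  expectation into \<open>L * E \<bar>\<nu> - Q \<nu>\<bar>\<close>.

  What is left is to see that the responses are integrable, being bounded and measurable (for \<open>Q\<close>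
  because there are only countably many cells), and that the Stieltjes measure of \<open>P\<close> is the law of
  \<open>\<nu>\<close>, so that both means become expectations over the same probability space.
\<close>

lemma the_fixpointD:
  assumes "z = (THE x. x = F x)" and "\<exists>!x. x = F x"
  shows "z = F z"
  unfolding assms(1) using theI'[of "\<lambda>x. x = F x", OF assms(2)] .

lemma best_response_in_interval:
  assumes "unique_maximizer a b u"
  shows "best_response a b u z t \<in> {a..b}"
proof -
  obtain x where "is_arg_max (\<lambda>x. u x z t) (\<lambda>x. x \<in> {a..b}) x"
    using assms unfolding unique_maximizer_def by blast
  then have "is_arg_max (\<lambda>x. u x z t) (\<lambda>x. x \<in> {a..b}) (best_response a b u z t)"
    unfolding best_response_def arg_max_on_def arg_max_def by (rule someI)
  then show ?thesis
    by (simp add: is_arg_max_def)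
qed

lemma lipschitz_imp_borel_measurable:
  fixes f :: "real \<Rightarrow> real"
  assumes "0 \<le> L" and "\<And>t t'. \<bar>f t - f t'\<bar> \<le> L * \<bar>t - t'\<bar>"
  shows "f \<in> borel_measurable borel"
proof -
  have "L-lipschitz_on UNIV f"
    using assms by (intro lipschitz_onI) (auto simp: dist_real_def)
  then show ?thesis
    by (intro borel_measurable_continuous_onI lipschitz_on_continuous_on)
qed

text \<open>The preimage of any set whatsoever is a union of cells, hence a countable union of Borel sets.\<close>

lemma quantization_scheme_measurable:
  assumes "quantization_scheme \<B> q Q"
  shows "Q \<in> borel_measurable borel"
proof (rule measurableI)
  fix A :: "real set"
  have cells: "\<Union>\<B> = UNIV" "countable \<B>" "\<B> \<subseteq> sets borel"
    and Q: "\<And>B t. B \<in> \<B> \<Longrightarrow> t \<in> B \<Longrightarrow> Q t = q B"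
    using assms by (auto simp: quantization_scheme_def partition_on_def)
  have "Q -` A = \<Union>{B \<in> \<B>. q B \<in> A}"
  proof (intro set_eqI iffI)
    fix t assume "t \<in> Q -` A"
    moreover obtain B where "B \<in> \<B>" "t \<in> B"
      using cells(1) by blast
    ultimately show "t \<in> \<Union>{B \<in> \<B>. q B \<in> A}"
      using Q by auto
  qed (use Q in auto)
  moreover have "\<Union>{B \<in> \<B>. q B \<in> A} \<in> sets borel"
    using cells(2,3) by (intro sets.countable_Union) (auto intro: countable_subset)
  ultimately show "Q -` A \<inter> space borel \<in> sets borel"
    by simp
qed simp

lemma interval_measure_eq_distr:
  assumes "prob_space M" and "\<nu> \<in> borel_measurable M"
    and "distribution_function P" and "cdf (distr M borel \<nu>) = P"
  shows "interval_measure P = distr M borel \<nu>"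
proof -
  interpret prob_space M by fact
  have P: "\<And>x y. x \<le> y \<Longrightarrow> P x \<le> P y" "\<And>x. continuous (at_right x) P"
      "(P \<longlongrightarrow> 0) at_bot" "(P \<longlongrightarrow> 1) at_top"
    using assms(3) by (auto simp: distribution_function_def mono_def)
  have "cdf (interval_measure P) = cdf (distr M borel \<nu>)"
    using P assms(4) by (simp add: cdf_interval_measure)
  moreover have "real_distribution (interval_measure P)"
    using P by (intro real_distribution_interval_measure)
  ultimately show ?thesis
    using assms(2) by (intro cdf_unique) auto
qed

context prob_space
begin

lemma mean_lipschitz:
  fixes f :: "real \<Rightarrow> 'a \<Rightarrow> real"
  assumes int: "\<And>z. integrable M (f z)"
    and lip: "\<And>z z' \<omega>. \<bar>f z \<omega> - f z' \<omega>\<bar> \<le> c * \<bar>z - z'\<bar>"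
  shows "\<bar>(LINT \<omega>|M. f z \<omega>) - (LINT \<omega>|M. f z' \<omega>)\<bar> \<le> c * \<bar>z - z'\<bar>"
proof -
  have "\<bar>(LINT \<omega>|M. f z \<omega>) - (LINT \<omega>|M. f z' \<omega>)\<bar> = \<bar>LINT \<omega>|M. f z \<omega> - f z' \<omega>\<bar>"
    using int by simp
  also have "\<dots> \<le> (LINT \<omega>|M. \<bar>f z \<omega> - f z' \<omega>\<bar>)"
    by (rule integral_abs_bound)
  also have "\<dots> \<le> (LINT \<omega>|M. c * \<bar>z - z'\<bar>)"
    using int lip by (intro integral_mono) auto
  finally show ?thesis
    by (simp add: prob_space)
qed

lemma ex1_mean_fixpoint:
  fixes f :: "real \<Rightarrow> 'a \<Rightarrow> real"
  assumes "\<And>z. integrable M (f z)" and "0 \<le> c" and "c < 1"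
    and "\<And>z z' \<omega>. \<bar>f z \<omega> - f z' \<omega>\<bar> \<le> c * \<bar>z - z'\<bar>"
  shows "\<exists>!z. z = (LINT \<omega>|M. f z \<omega>)"
proof -
  have "\<exists>!z. (LINT \<omega>|M. f z \<omega>) = z"
    using mean_lipschitz[OF assms(1,4)] assms(2,3)
    by (intro banach_fix_type) (auto simp: dist_real_def)
  then show ?thesis
    by (simp only: eq_commute)
qed

text \<open>The bound is stated in the extended reals so that it also covers an infinite expected
  discrepancy between \<open>f\<close> and \<open>g\<close>; the absorption of the contraction term takes place between
  real numbers before the bound is applied.\<close>

lemma mean_fixpoint_perturbation:
  fixes f g :: "real \<Rightarrow> 'a \<Rightarrow> real"
  assumes f: "\<And>z. integrable M (f z)" and g: "integrable M (g z')"
    and lip: "\<And>z z' \<omega>. \<bar>f z \<omega> - f z' \<omega>\<bar> \<le> c * \<bar>z - z'\<bar>" and "c < 1"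
    and z: "z = (LINT \<omega>|M. f z \<omega>)" and z': "z' = (LINT \<omega>|M. g z' \<omega>)"
  shows "ennreal \<bar>z - z'\<bar>
    \<le> ennreal (1 / (1 - c)) * (\<integral>\<^sup>+ \<omega>. ennreal \<bar>f z' \<omega> - g z' \<omega>\<bar> \<partial>M)"
proof -
  define d where "d = (LINT \<omega>|M. f z' \<omega> - g z' \<omega>)"
  have d: "d = (LINT \<omega>|M. f z' \<omega>) - z'"
    unfolding d_def using f g z' by simp
  have "\<bar>z - (LINT \<omega>|M. f z' \<omega>)\<bar> \<le> c * \<bar>z - z'\<bar>"
    using mean_lipschitz[OF f lip, of z z'] z by simp
  then have "(1 - c) * \<bar>z - z'\<bar> \<le> \<bar>d\<bar>"
    unfolding d by (simp add: algebra_simps)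
  then have "\<bar>z - z'\<bar> \<le> 1 / (1 - c) * \<bar>d\<bar>"
    using \<open>c < 1\<close> by (simp add: field_simps)
  then have "ennreal \<bar>z - z'\<bar> \<le> ennreal (1 / (1 - c)) * ennreal \<bar>d\<bar>"
    using \<open>c < 1\<close> by (simp add: ennreal_leI flip: ennreal_mult)
  also have "ennreal \<bar>d\<bar> \<le> (\<integral>\<^sup>+ \<omega>. ennreal \<bar>f z' \<omega> - g z' \<omega>\<bar> \<partial>M)"
    unfolding d_def using integral_norm_bound_ennreal[of M "\<lambda>\<omega>. f z' \<omega> - g z' \<omega>"] f g by simp
  finally show ?thesis
    by (simp add: mult_left_mono)
qed

end

theorem proposition1:
  fixes a b L Lz :: real
    and u :: "real \<Rightarrow> real \<Rightarrow> real \<Rightarrow> real"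
    and \<alpha> :: "nat \<Rightarrow> real"
    and P :: "real \<Rightarrow> real"
    and \<B> :: "real set set" and q :: "real set \<Rightarrow> real" and Q :: "real \<Rightarrow> real"
    and M :: "'w measure" and \<nu> :: "'w \<Rightarrow> real"
  assumes "a \<le> b"
    and "unique_maximizer a b u"
    and "0 < Lz" and "Lz < 1"
    and "\<And>z z' t. \<bar>best_response a b u z t - best_response a b u z' t\<bar> \<le> Lz * \<bar>z - z'\<bar>"
    and "0 < L"
    and "\<And>z t t'. \<bar>best_response a b u z t - best_response a b u z t'\<bar> \<le> L * \<bar>t - t'\<bar>"
    and "distribution_function P" and "continuous_on UNIV P"
    and "\<And>x. (\<lambda>n. empirical_df \<alpha> n x) \<longlonglongrightarrow> P x"
    and "quantization_scheme \<B> q Q"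
    and "prob_space M" and "\<nu> \<in> borel_measurable M" and "cdf (distr M borel \<nu>) = P"
  shows "ennreal \<bar>aem a b u P - aem_approx a b u M \<nu> Q\<bar>
    \<le> ennreal (L / (1 - Lz)) * (\<integral>\<^sup>+ \<omega>. ennreal \<bar>\<nu> \<omega> - Q (\<nu> \<omega>)\<bar> \<partial>M)"
proof -
  interpret prob_space M by fact
  let ?Br = "best_response a b u"
  note \<nu> [measurable] = \<open>\<nu> \<in> borel_measurable M\<close>
  have Br_meas [measurable]: "?Br z \<in> borel_measurable borel" for z
    using assms(6,7) by (intro lipschitz_imp_borel_measurable[of L]) auto
  have Q_meas [measurable]: "Q \<in> borel_measurable borel"
    using \<open>quantization_scheme \<B> q Q\<close> by (rule quantization_scheme_measurable)
  have bounded: "norm (?Br z t) \<le> max \<bar>a\<bar> \<bar>b\<bar>" for z t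
    using best_response_in_interval[OF assms(2), of z t] by auto
  have int: "integrable M (\<lambda>\<omega>. ?Br z (\<nu> \<omega>))" for z
    using bounded by (intro integrable_const_bound[where B="max \<bar>a\<bar> \<bar>b\<bar>"]) auto
  have int_Q: "integrable M (\<lambda>\<omega>. ?Br z (Q (\<nu> \<omega>)))" for z
    using bounded by (intro integrable_const_bound[where B="max \<bar>a\<bar> \<bar>b\<bar>"]) auto

  define z where "z = aem a b u P"
  define z' where "z' = aem_approx a b u M \<nu> Q"
  have law: "interval_measure P = distr M borel \<nu>"
    using assms(8,12-14) by (intro interval_measure_eq_distr)
  have "z = (THE z. z = (LINT \<omega>|M. ?Br z (\<nu> \<omega>)))"
    unfolding z_def aem_def law by (simp add: integral_distr)
  moreover have "\<exists>!z. z = (LINT \<omega>|M. ?Br z (\<nu> \<omega>))"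
    using int assms(3-5) by (intro ex1_mean_fixpoint[where c = Lz]) auto
  ultimately have z: "z = (LINT \<omega>|M. ?Br z (\<nu> \<omega>))"
    by (rule the_fixpointD)
  have "z' = (THE z. z = (LINT \<omega>|M. ?Br z (Q (\<nu> \<omega>))))"
    unfolding z'_def aem_approx_def ..
  moreover have "\<exists>!z. z = (LINT \<omega>|M. ?Br z (Q (\<nu> \<omega>)))"
    using int_Q assms(3-5) by (intro ex1_mean_fixpoint[where c = Lz]) auto
  ultimately have z': "z' = (LINT \<omega>|M. ?Br z' (Q (\<nu> \<omega>)))"
    by (rule the_fixpointD)

  have "ennreal \<bar>z - z'\<bar>
      \<le> ennreal (1 / (1 - Lz)) * (\<integral>\<^sup>+ \<omega>. ennreal \<bar>?Br z' (\<nu> \<omega>) - ?Br z' (Q (\<nu> \<omega>))\<bar> \<partial>M)"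
    using int int_Q assms(5) assms(4) z z' by (rule mean_fixpoint_perturbation)
  also have "\<dots> \<le> ennreal (1 / (1 - Lz)) * (\<integral>\<^sup>+ \<omega>. ennreal (L * \<bar>\<nu> \<omega> - Q (\<nu> \<omega>)\<bar>) \<partial>M)"
    using assms(7) by (intro mult_left_mono nn_integral_mono ennreal_leI) auto
  also have "\<dots> = ennreal (1 / (1 - Lz)) * (ennreal L * (\<integral>\<^sup>+ \<omega>. ennreal \<bar>\<nu> \<omega> - Q (\<nu> \<omega>)\<bar> \<partial>M))"
    using \<open>0 < L\<close> by (simp add: ennreal_mult nn_integral_cmult)
  also have "\<dots> = ennreal (L / (1 - Lz)) * (\<integral>\<^sup>+ \<omega>. ennreal \<bar>\<nu> \<omega> - Q (\<nu> \<omega>)\<bar> \<partial>M)"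
    using \<open>0 < L\<close> \<open>Lz < 1\<close> by (simp add: mult.assoc[symmetric] flip: ennreal_mult)
  finally show ?thesis
    unfolding z_def z'_def .
qed

end
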